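(* If $Y^*$ is optimal for the primal SDP, $(\lambda_{ij}^*,\rho^* )$ is optimal for the dual SDP, and $I+\sum_{i<j}\lambda_{ij}^*H_{ij}\succ0$, then $\operatorname{rank}(Y^* )=1$ and the triangulation problem is SDP-EXACT.
   Context: Let $n\ge 2$ and let $P_1,\dots,P_n\in\mathbb{R}^{3\times 4}$ be projective cameras (rank $3$ matrices) with pairwise distinct centers (the center of $P_i$ is its one-dimensional kernel viewed as a point of projective $3$-space). Let $\widehat x\in\mathbb{R}^{2n}$ be a vector of image observations. For a vector $y$, $\tilde y=[y;1]$ (append a last entry $1$). $\mathcal{S}^k$ is the space of real symmetric $k\times k$ matrices with inner product $\langle A,B\rangle=\sum_{i,j}A_{ij}B_{ij}$, and $\mathcal{S}^k_+$ is the cone of positive semidefinite ones. Write $x=[x_1;\dots;x_n]\in\mathbb{R}^{2n}$ with $x_i\in\mathbb{R}^2$. For $i<j$ let $f_{ij}(x)=\tilde x_i^\top\Phi_{ij}\tilde x_j$, where $\Phi_{ij}\in\mathbb{R}^{3\times3}$ is the fundamental matrix of cameras $i,j$, i.e. up to a (fixed) nonzero scalar the rank-2 matrix given by $\tilde x_i^\top \Phi_{ij}\tilde x_j=\det\begin{bmatrix}P_i&\tilde x_i&0\\P_j&0&\tilde x_j\end{bmatrix}$. Let $F_{ij}\in\mathcal{S}^{2n+1}$ be the symmetric matrix with $f_{ij}(x)=\tilde x^\top F_{ij}\tilde x$, and let $H_{ij}\in\mathcal{S}^{2n}$ be its top left $2n\times2n$ block. Let $g(x)=\|x-\widehat x\|^2=\tilde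 x^\top G\tilde x$ with $G=\begin{bmatrix}I&-\widehat x\\-\widehat x^\top&\|\widehat x\|^2\end{bmatrix}$, and let $E\in\mathcal{S}^{2n+1}$ be zero except for its bottom right entry, which is $1$. Define the optimization problems and their optimal values: - $g^{\rm quad}$: minimum of $g(x)$ subject to $f_{ij}(x)=0$ for all $1\le i<j\le n$, $x\in\mathbb{R}^{2n}$; - primal SDP, with optimal value $g^{\rm mom}$: minimize $\langle G,Y\rangle$ subject to $\langle F_{ij},Y\rangle=0$ for all $i<j$, $\langle E,Y\rangle=1$, $Y\in\mathcal{S}^{2n+1}_+$; - dual SDP, with optimal value $g^{\rm sos}$: maximize $\rho$ subject to $G+\sum_{i<j}\lambda_{ij}F_{ij}-\rho E\succeq0$, $\lambda_{ij},\rho\in\mathbb{R}$. The triangulation problem is called SDP-EXACT if $g^{\rm quad}=g^{\rm sos}=g^{\rm mom}$. *)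

theory Defs
  imports "HOL-Analysis.Analysis"
begin

section \<open>Cameras and fundamental matrices\<close>

text \<open>The center of a camera, a point of projective 3-space, is represented by the corresponding
  linear subspace of \<open>\<real>\<^sup>4\<close>, namely the kernel.\<close>

definition camera_center :: "real^4^3 \<Rightarrow> (real^4) set" where
  "camera_center P = {v. P *v v = 0}"

definition homog2 :: "real^2 \<Rightarrow> real^3" where
  "homog2 u = vector [u$1, u$2, 1]"

definition two_view_matrix :: "real^4^3 \<Rightarrow> real^4^3 \<Rightarrow> real^3 \<Rightarrow> real^3 \<Rightarrow> real^6^6" where
  "two_view_matrix P Q u v = vector
    [vector [P$1$1, P$1$2, P$1$3, P$1$4, u$1, 0],
     vector [P$2$1, P$2$2, P$2$3, P$2$4, u$2, 0],
     vector [P$3$1, P$3$2, P$3$3, P$3$4, u$3, 0],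
     vector [Q$1$1, Q$1$2, Q$1$3, Q$1$4, 0, v$1],
     vector [Q$2$1, Q$2$2, Q$2$3, Q$2$4, 0, v$2],
     vector [Q$3$1, Q$3$2, Q$3$3, Q$3$4, 0, v$3]]"

text \<open>Fundamental matrices are only determined up to a nonzero scalar.\<close>

definition is_fundamental_matrix :: "real^4^3 \<Rightarrow> real^4^3 \<Rightarrow> real^3^3 \<Rightarrow> bool" where
  "is_fundamental_matrix P Q \<Phi> \<longleftrightarrow>
    (\<exists>c. c \<noteq> 0 \<and> (\<forall>u v. homog2 u \<bullet> (\<Phi> *v homog2 v)
                      = c * det (two_view_matrix P Q (homog2 u) (homog2 v))))"

section \<open>Quadratic functions and symmetric matrices\<close>

text \<open>The \<open>n\<close> images are indexed by a finite linearly ordered type \<open>'n\<close>. A vector of \<open>\<real>\<^sup>2\<^sup>n\<close>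
  has type \<open>real^('n \<times> 2)\<close>; a vector of \<open>\<real>\<^sup>2\<^sup>n\<^sup>+\<^sup>1\<close> has type \<open>real^(('n \<times> 2) option)\<close>, the last
  coordinate being the one at \<open>None\<close>.\<close>

definition image_point :: "real^('n::finite \<times> 2) \<Rightarrow> 'n \<Rightarrow> real^2" where
  "image_point x i = (\<chi> k. x $ (i, k))"

definition homog :: "real^'a::finite \<Rightarrow> real^('a option)" where
  "homog y = (\<chi> r. case r of Some a \<Rightarrow> y $ a | None \<Rightarrow> 1)"

definition pos_semidef :: "real^'a::finite^'a \<Rightarrow> bool" where
  "pos_semidef A \<longleftrightarrow> transpose A = A \<and> (\<forall>v. 0 \<le> v \<bullet> (A *v v))"

definition pos_def :: "real^'a::finite^'a \<Rightarrow> bool" where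
  "pos_def A \<longleftrightarrow> transpose A = A \<and> (\<forall>v. v \<noteq> 0 \<longrightarrow> 0 < v \<bullet> (A *v v))"

definition represents_quadratic ::
    "real^('a::finite option)^('a option) \<Rightarrow> (real^'a \<Rightarrow> real) \<Rightarrow> bool" where
  "represents_quadratic A q \<longleftrightarrow>
    transpose A = A \<and> (\<forall>x. q x = homog x \<bullet> (A *v homog x))"

definition quadratic_matrix :: "(real^'a::finite \<Rightarrow> real) \<Rightarrow> real^('a option)^('a option)" where
  "quadratic_matrix q = (THE A. represents_quadratic A q)"

definition top_left_block :: "real^('a::finite option)^('a option) \<Rightarrow> real^'a^'a" where
  "top_left_block A = (\<chi> a b. A $ Some a $ Some b)"

section \<open>The triangulation problem and its semidefinite relaxation\<close>

definition epipolar_form ::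
    "('n::finite \<Rightarrow> 'n \<Rightarrow> real^3^3) \<Rightarrow> 'n \<Rightarrow> 'n \<Rightarrow> real^('n \<times> 2) \<Rightarrow> real" where
  "epipolar_form \<Phi> i j x = homog2 (image_point x i) \<bullet> (\<Phi> i j *v homog2 (image_point x j))"

definition F_mat ::
    "('n::finite \<Rightarrow> 'n \<Rightarrow> real^3^3) \<Rightarrow> 'n \<Rightarrow> 'n \<Rightarrow> real^(('n \<times> 2) option)^(('n \<times> 2) option)" where
  "F_mat \<Phi> i j = quadratic_matrix (epipolar_form \<Phi> i j)"

definition H_mat ::
    "('n::finite \<Rightarrow> 'n \<Rightarrow> real^3^3) \<Rightarrow> 'n \<Rightarrow> 'n \<Rightarrow> real^('n \<times> 2)^('n \<times> 2)" where
  "H_mat \<Phi> i j = top_left_block (F_mat \<Phi> i j)"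

definition G_mat :: "real^'a::finite \<Rightarrow> real^('a option)^('a option)" where
  "G_mat xh = (\<chi> r c. case (r, c) of
      (Some a, Some b) \<Rightarrow> (if a = b then 1 else 0)
    | (Some a, None) \<Rightarrow> - xh $ a
    | (None, Some b) \<Rightarrow> - xh $ b
    | (None, None) \<Rightarrow> (norm xh)\<^sup>2)"

definition E_mat :: "real^('a::finite option)^('a option)" where
  "E_mat = (\<chi> r c. if r = None \<and> c = None then 1 else 0)"

definition quad_feasible :: "('n::{finite,linorder} \<Rightarrow> 'n \<Rightarrow> real^3^3) \<Rightarrow> (real^('n \<times> 2)) set" where
  "quad_feasible \<Phi> = {x. \<forall>i j. i < j \<longrightarrow> epipolar_form \<Phi> i j x = 0}"

text \<open>On matrices, \<open>\<bullet>\<close> is the entrywise inner product.\<close>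

definition primal_feasible ::
    "('n::{finite,linorder} \<Rightarrow> 'n \<Rightarrow> real^3^3) \<Rightarrow> (real^(('n \<times> 2) option)^(('n \<times> 2) option)) set" where
  "primal_feasible \<Phi> =
    {Y. (\<forall>i j. i < j \<longrightarrow> F_mat \<Phi> i j \<bullet> Y = 0) \<and> E_mat \<bullet> Y = 1 \<and> pos_semidef Y}"

text \<open>Only the multipliers \<open>\<lambda> i j\<close> with \<open>i < j\<close> matter.\<close>

definition dual_feasible ::
    "('n::{finite,linorder} \<Rightarrow> 'n \<Rightarrow> real^3^3) \<Rightarrow> real^('n \<times> 2) \<Rightarrow> (('n \<Rightarrow> 'n \<Rightarrow> real) \<times> real) set" where
  "dual_feasible \<Phi> xh =
    {(lam, \<rho>). pos_semidef
       (G_mat xh + (\<Sum>(i, j)\<in>{(i, j). i < j}. lam i j *\<^sub>R F_mat \<Phi> i j) - \<rho> *\<^sub>R E_mat)}"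

definition primal_optimal ::
    "('n::{finite,linorder} \<Rightarrow> 'n \<Rightarrow> real^3^3) \<Rightarrow> real^('n \<times> 2) \<Rightarrow>
     real^(('n \<times> 2) option)^(('n \<times> 2) option) \<Rightarrow> bool" where
  "primal_optimal \<Phi> xh Y \<longleftrightarrow>
    Y \<in> primal_feasible \<Phi> \<and> (\<forall>Y'\<in>primal_feasible \<Phi>. G_mat xh \<bullet> Y \<le> G_mat xh \<bullet> Y')"

definition dual_optimal ::
    "('n::{finite,linorder} \<Rightarrow> 'n \<Rightarrow> real^3^3) \<Rightarrow> real^('n \<times> 2) \<Rightarrow> ('n \<Rightarrow> 'n \<Rightarrow> real) \<Rightarrow> real \<Rightarrow> bool" where
  "dual_optimal \<Phi> xh lam \<rho> \<longleftrightarrow>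
    (lam, \<rho>) \<in> dual_feasible \<Phi> xh \<and> (\<forall>(lam', \<rho>')\<in>dual_feasible \<Phi> xh. \<rho>' \<le> \<rho>)"

text \<open>Optimal values are extended reals, so that they are meaningful for infeasible, unbounded or
  unattained problems as well.\<close>

definition g_quad :: "('n::{finite,linorder} \<Rightarrow> 'n \<Rightarrow> real^3^3) \<Rightarrow> real^('n \<times> 2) \<Rightarrow> ereal" where
  "g_quad \<Phi> xh = (INF x\<in>quad_feasible \<Phi>. ereal ((norm (x - xh))\<^sup>2))"

definition g_mom :: "('n::{finite,linorder} \<Rightarrow> 'n \<Rightarrow> real^3^3) \<Rightarrow> real^('n \<times> 2) \<Rightarrow> ereal" where
  "g_mom \<Phi> xh = (INF Y\<in>primal_feasible \<Phi>. ereal (G_mat xh \<bullet> Y))"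

definition g_sos :: "('n::{finite,linorder} \<Rightarrow> 'n \<Rightarrow> real^3^3) \<Rightarrow> real^('n \<times> 2) \<Rightarrow> ereal" where
  "g_sos \<Phi> xh = (SUP (lam, \<rho>)\<in>dual_feasible \<Phi> xh. ereal \<rho>)"

definition sdp_exact :: "('n::{finite,linorder} \<Rightarrow> 'n \<Rightarrow> real^3^3) \<Rightarrow> real^('n \<times> 2) \<Rightarrow> bool" where
  "sdp_exact \<Phi> xh \<longleftrightarrow> g_quad \<Phi> xh = g_sos \<Phi> xh \<and> g_sos \<Phi> xh = g_mom \<Phi> xh"

section \<open>Well-definedness\<close>

lemma UNIV_6: "(UNIV :: 6 set) = {1, 2, 3, 4, 5, 6}"
proof -
  have "card {1, 2, 3, 4, 5, 6 :: 6} = card (UNIV :: 6 set)"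
    by simp
  then show ?thesis
    by (metis card_subset_eq finite_UNIV top_greatest finite)
qed

lemma forall_6: "(\<forall>i::6. Q i) \<longleftrightarrow> Q 1 \<and> Q 2 \<and> Q 3 \<and> Q 4 \<and> Q 5 \<and> Q 6"
  using UNIV_6 by (metis UNIV_I empty_iff insert_iff)

lemma vector_6:
  "(vector [a, b, c, d, e, f] :: 'a::zero^6) $ 1 = a"
  "(vector [a, b, c, d, e, f] :: 'a::zero^6) $ 2 = b"
  "(vector [a, b, c, d, e, f] :: 'a::zero^6) $ 3 = c"
  "(vector [a, b, c, d, e, f] :: 'a::zero^6) $ 4 = d"
  "(vector [a, b, c, d, e, f] :: 'a::zero^6) $ 5 = e"
  "(vector [a, b, c, d, e, f] :: 'a::zero^6) $ 6 = f"
  unfolding vector_def by simp_all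

lemma linear_det_two_view_matrix_left:
  "linear (\<lambda>u. det (two_view_matrix P Q u v))"
proof -
  define L :: "real^3 \<Rightarrow> real^6" where "L = (\<lambda>u. vector [u$1, u$2, u$3, 0, 0, 0])"
  define R where "R = (\<lambda>i. column i (two_view_matrix P Q 0 v))"
  have eq: "transpose (two_view_matrix P Q u v) = (\<chi> i. if i = 5 then L u else R i)" for u
    by (simp add: vec_eq_iff forall_6 vector_6 two_view_matrix_def transpose_def L_def R_def
        column_def)
  have add: "L (u + w) = L u + L w" and scale: "L (c *\<^sub>R u) = c *s L u" for u w c
    by (simp_all add: L_def vec_eq_iff forall_6 vector_6)
  have "det (two_view_matrix P Q u v) = det (\<chi> i. if i = 5 then L u else R i)" for u
    by (metis eq det_transpose)
  then show ?thesis
    by (intro linearI) (simp_all only: add scale det_row_add det_row_mul real_scaleR_def)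
qed

lemma linear_det_two_view_matrix_right:
  "linear (\<lambda>v. det (two_view_matrix P Q u v))"
proof -
  define L :: "real^3 \<Rightarrow> real^6" where "L = (\<lambda>v. vector [0, 0, 0, v$1, v$2, v$3])"
  define R where "R = (\<lambda>i. column i (two_view_matrix P Q u 0))"
  have eq: "transpose (two_view_matrix P Q u v) = (\<chi> i. if i = 6 then L v else R i)" for v
    by (simp add: vec_eq_iff forall_6 vector_6 two_view_matrix_def transpose_def L_def R_def
        column_def)
  have add: "L (v + w) = L v + L w" and scale: "L (c *\<^sub>R v) = c *s L v" for v w c
    by (simp_all add: L_def vec_eq_iff forall_6 vector_6)
  have "det (two_view_matrix P Q u v) = det (\<chi> i. if i = 6 then L v else R i)" for v
    by (metis eq det_transpose)
  then show ?thesis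
    by (intro linearI) (simp_all only: add scale det_row_add det_row_mul real_scaleR_def)
qed

lemma is_fundamental_matrix_ex: "\<exists>\<Phi>. is_fundamental_matrix P Q \<Phi>"
proof -
  let ?d = "\<lambda>u v. det (two_view_matrix P Q u v)"
  have exp: "w = w$1 *\<^sub>R axis 1 1 + w$2 *\<^sub>R axis 2 1 + w$3 *\<^sub>R axis 3 1" for w :: "real^3"
    by (simp add: vec_eq_iff forall_3 axis_def)
  define \<Phi> :: "real^3^3" where "\<Phi> = (\<chi> a b. ?d (axis a 1) (axis b 1))"
  have left: "?d u v = (\<Sum>a\<in>UNIV. u$a * ?d (axis a 1) v)" for u v
    by (subst exp[of u]) (simp only: linear_add[OF linear_det_two_view_matrix_left]
        linear_cmul[OF linear_det_two_view_matrix_left] real_scaleR_def sum_3)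
  have right: "?d u v = (\<Sum>b\<in>UNIV. v$b * ?d u (axis b 1))" for u v
    by (subst exp[of v]) (simp only: linear_add[OF linear_det_two_view_matrix_right]
        linear_cmul[OF linear_det_two_view_matrix_right] real_scaleR_def sum_3)
  have "u \<bullet> (\<Phi> *v v) = ?d u v" for u v
  proof -
    have "(\<Phi> *v v) $ a = ?d (axis a 1) v" for a
      by (subst right) (simp add: \<Phi>_def matrix_vector_mult_def mult.commute)
    then show ?thesis
      by (subst left) (simp add: inner_vec_def)
  qed
  then show ?thesis
    unfolding is_fundamental_matrix_def by (intro exI[of _ \<Phi>] exI[of _ 1]) simp
qed

lemma matrix_entry_inner: "axis r 1 \<bullet> (A *v axis c 1) = (A::real^'c::finite^'r::finite) $ r $ c"
  by (simp add: inner_axis' matrix_vector_mul_component inner_axis)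

lemma represents_quadratic_unique:
  fixes A B :: "real^('a::finite option)^('a option)"
  assumes "represents_quadratic A q" "represents_quadratic B q"
  shows "A = B"
proof -
  define D where "D = A - B"
  have "transpose D = D"
    using assms by (simp add: represents_quadratic_def D_def transpose_def vec_eq_iff)
  then have sym: "D $ r $ c = D $ c $ r" for r c
    by (simp add: transpose_def vec_eq_iff)
  have "homog x \<bullet> (A *v homog x) = homog x \<bullet> (B *v homog x)" for x
    using assms unfolding represents_quadratic_def by simp
  then have D0: "homog x \<bullet> (D *v homog x) = 0" for x
    by (simp only: D_def matrix_vector_mult_diff_rdistrib inner_diff_right)
  let ?e = "\<lambda>a. axis (Some a) 1 :: real^('a option)"
  let ?o = "axis None 1 :: real^('a option)"
  have h: "homog (s *\<^sub>R axis a 1 + t *\<^sub>R axis b 1) = ?o + s *\<^sub>R ?e a + t *\<^sub>R ?e b" for s t a b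
    by (auto simp: homog_def vec_eq_iff axis_def split: option.splits)
  have expand: "D$None$None + s * s * D$Some a$Some a + t * t * D$Some b$Some b
      + 2 * s * D$None$Some a + 2 * t * D$None$Some b + 2 * s * t * D$Some a$Some b = 0" for s t a b
  proof -
    have "(?o + s *\<^sub>R ?e a + t *\<^sub>R ?e b) \<bullet>
        (D *v ?o + s *\<^sub>R (D *v ?e a) + t *\<^sub>R (D *v ?e b)) = 0"
      using D0[of "s *\<^sub>R axis a 1 + t *\<^sub>R axis b 1"]
      unfolding h by (simp only: matrix_vector_right_distrib matrix_vector_mult_scaleR)
    then show ?thesis
      unfolding inner_add_left inner_add_right inner_scaleR_left inner_scaleR_right
        matrix_entry_inner sym[of "Some a" None] sym[of "Some b" None] sym[of "Some b" "Some a"]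
      by (simp only: algebra_simps)
  qed
  have NN: "D$None$None = 0" using expand[of 0 undefined 0 undefined] by simp
  have NS: "D$None$Some a = 0" "D$Some a$Some a = 0" for a
    using expand[of 1 a 0 a] expand[of "-1" a 0 a] NN by auto
  have SS: "D$Some a$Some b = 0" for a b
    using expand[of 1 a 1 b] NS NN by simp
  have "D $ r $ c = 0" for r c
    using NN NS SS sym by (cases r; cases c) auto
  then have "D = 0" by (simp add: vec_eq_iff)
  then show ?thesis by (simp add: D_def)
qed

lemma represents_epipolar_form_ex:
  "\<exists>A. represents_quadratic A (epipolar_form \<Phi> i j)"
proof -
  define S :: "'a \<Rightarrow> real^(('a \<times> 2) option)^3" where
    "S = (\<lambda>i. vector [axis (Some (i, 1)) 1, axis (Some (i, 2)) 1, axis None 1])"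
  have S: "S i *v homog x = homog2 (image_point x i)" for i x
    by (simp add: S_def homog2_def image_point_def vec_eq_iff forall_3 matrix_vector_mul_component
        inner_axis' homog_def)
  define B where "B = transpose (S i) ** \<Phi> i j ** S j"
  have B: "epipolar_form \<Phi> i j x = homog x \<bullet> (B *v homog x)" for x
  proof -
    have "homog x \<bullet> (B *v homog x)
        = homog x \<bullet> (transpose (S i) *v (\<Phi> i j *v (S j *v homog x)))"
      by (simp only: B_def matrix_vector_mul_assoc matrix_mul_assoc)
    also have "\<dots> = (S i *v homog x) \<bullet> (\<Phi> i j *v (S j *v homog x))"
      by (simp only: dot_lmul_matrix[symmetric] vector_transpose_matrix)
    finally show ?thesis
      by (simp only: S epipolar_form_def)
  qed
  have Bt: "homog x \<bullet> (transpose B *v homog x) = homog x \<bullet> (B *v homog x)" for x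
    by (simp only: transpose_matrix_vector dot_lmul_matrix inner_commute[of "homog x" "homog x v* B"])
  have tr: "transpose ((1/2) *\<^sub>R (B + transpose B)) = (1/2) *\<^sub>R (B + transpose B)"
    by (simp add: transpose_def vec_eq_iff)
  have "homog x \<bullet> (((1/2) *\<^sub>R (B + transpose B)) *v homog x) = homog x \<bullet> (B *v homog x)" for x
    by (simp only: scaleR_matrix_vector_assoc[symmetric] matrix_vector_mult_add_rdistrib
        inner_add_right inner_scaleR_right Bt) simp
  with tr B show ?thesis
    unfolding represents_quadratic_def by metis
qed

lemma F_mat_represents: "represents_quadratic (F_mat \<Phi> i j) (epipolar_form \<Phi> i j)"
  unfolding F_mat_def quadratic_matrix_def
  by (rule theI') (use represents_epipolar_form_ex represents_quadratic_unique in blast)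

lemma sum_UNIV_option:
  "(\<Sum>r\<in>UNIV. f r) = f None + (\<Sum>a\<in>UNIV. f (Some a))" for f :: "'a::finite option \<Rightarrow> real"
  by (simp add: UNIV_option_conv sum.reindex)

lemma G_mat_represents: "represents_quadratic (G_mat xh) (\<lambda>x. (norm (x - xh))\<^sup>2)"
proof -
  have "transpose (G_mat xh) = G_mat xh"
    by (auto simp: transpose_def G_mat_def vec_eq_iff split: option.splits)
  moreover have "(norm (x - xh))\<^sup>2 = homog x \<bullet> (G_mat xh *v homog x)" for x
  proof -
    have "(G_mat xh *v homog x) $ r
        = (case r of Some a \<Rightarrow> x $ a - xh $ a | None \<Rightarrow> (norm xh)\<^sup>2 - xh \<bullet> x)" for r
    proof (cases r)
      case None
      then show ?thesis
        by (simp add: matrix_vector_mult_def sum_UNIV_option G_mat_def homog_def inner_vec_def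
            sum_negf)
    next
      case (Some a)
      have "(\<Sum>b\<in>UNIV. (if a = b then 1 else 0) * x $ b) = (\<Sum>b\<in>UNIV. if a = b then x $ b else 0)"
        by (rule sum.cong) auto
      then have "(\<Sum>b\<in>UNIV. (if a = b then 1 else 0) * x $ b) = x $ a"
        by simp
      with Some show ?thesis
        by (simp add: matrix_vector_mult_def sum_UNIV_option G_mat_def homog_def)
    qed
    then have "homog x \<bullet> (G_mat xh *v homog x) = (norm xh)\<^sup>2 - xh \<bullet> x + x \<bullet> (x - xh)"
      by (simp add: inner_vec_def sum_UNIV_option) (simp add: homog_def)
    then show ?thesis
      by (simp add: power2_norm_eq_inner inner_diff_left inner_diff_right inner_commute)
  qed
  ultimately show ?thesis by (simp add: represents_quadratic_def)
qed

end

theory Submission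
  imports Defs
begin

text \<open>Let \<open>M = G + \<Sum> \<lambda>\<^sub>i\<^sub>j F\<^sub>i\<^sub>j - \<rho> E\<close> be the optimal dual slack matrix. Its quadratic form at the
  homogenization of \<open>x\<close> is the Lagrangian \<open>g(x) + \<Sum> \<lambda>\<^sub>i\<^sub>j f\<^sub>i\<^sub>j(x) - \<rho>\<close>, and its leading block is
  \<open>I + \<Sum> \<lambda>\<^sub>i\<^sub>j H\<^sub>i\<^sub>j\<close>. Since that block is positive definite, the Lagrangian is strictly convex and
  has a unique minimizer \<open>x\<close> (\<open>complete_square\<close>). Two consequences of dual optimality finish the
  argument.

  The minimum of the Lagrangian is zero, since otherwise \<open>\<rho>\<close> could be raised. And \<open>x\<close>
  satisfies every constraint \<open>f\<^sub>i\<^sub>j(x) = 0\<close>: the dual function at \<open>\<lambda>\<close> has partial derivatives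
  \<open>f\<^sub>i\<^sub>j(x)\<close>, so if one of them were nonzero, then moving \<open>\<lambda>\<^sub>i\<^sub>j\<close> slightly would make room for a
  larger \<open>\<rho>\<close> (\<open>improving_direction\<close>). Hence \<open>g(x) = \<rho>\<close> with \<open>x\<close> feasible for the
  quadratic problem, which closes the chain of relaxations.

  For the rank, the objective value of \<open>Y\<close> is at most that of the rank-one lift of \<open>x\<close>, so
  \<open>\<langle>M, Y\<rangle> \<le> 0\<close>. Writing \<open>Y\<close> as a sum of squares \<open>w w\<^sup>T\<close>
  (\<open>pos_semidef_sum_outer_squares\<close>) turns \<open>\<langle>M, Y\<rangle>\<close> into a sum of values of the positive
  semidefinite form of \<open>M\<close>, so every \<open>w\<close> is in the kernel of that form, which is the
  line spanned by the homogenization of \<open>x\<close>.\<close>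

section \<open>Rank-one decomposition of positive semidefinite matrices\<close>

definition outer_square :: "real^'a::finite \<Rightarrow> real^'a^'a" where
  "outer_square w = (\<chi> r c. w $ r * w $ c)"

lemma symmetric_form_commute:
  assumes "transpose A = A"
  shows "u \<bullet> (A *v v) = v \<bullet> (A *v (u :: real^'a::finite))"
  by (metis assms dot_lmul_matrix inner_commute transpose_matrix_vector)

lemma symmetric_form_add_scaleR:
  fixes A :: "real^'a::finite^'a"
  assumes "transpose A = A"
  shows "(u + t *\<^sub>R v) \<bullet> (A *v (u + t *\<^sub>R v))
    = u \<bullet> (A *v u) + 2 * t * (u \<bullet> (A *v v)) + t\<^sup>2 * (v \<bullet> (A *v v))"
  by (simp add: matrix_vector_right_distrib matrix_vector_mult_scaleR inner_add_left
      inner_add_right symmetric_form_commute[OF assms, of v u] power2_eq_square algebra_simps)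

lemma outer_square_mult_vec: "outer_square w *v v = (w \<bullet> v) *\<^sub>R w"
  by (simp add: vec_eq_iff outer_square_def matrix_vector_mult_def inner_vec_def
      sum_distrib_left sum_distrib_right mult_ac)

lemma inner_outer_square: "A \<bullet> outer_square w = w \<bullet> (A *v w)"
  by (simp add: inner_vec_def outer_square_def matrix_vector_mult_def sum_distrib_left mult_ac)

lemma outer_square_scaleR: "outer_square (t *\<^sub>R w) = t\<^sup>2 *\<^sub>R outer_square w"
  by (simp add: vec_eq_iff outer_square_def power2_eq_square)

lemma pos_semidef_outer_square: "pos_semidef (outer_square w)"
  by (auto simp: pos_semidef_def outer_square_mult_vec inner_commute)
     (simp add: vec_eq_iff outer_square_def transpose_def)

lemma rank_outer_square:
  assumes "w \<noteq> 0"
  shows "rank (outer_square w) = 1"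
proof -
  have "range ((*v) (outer_square w)) = span {w}"
  proof
    show "range ((*v) (outer_square w)) \<subseteq> span {w}"
      by (auto simp: outer_square_mult_vec span_singleton)
    show "span {w} \<subseteq> range ((*v) (outer_square w))"
    proof
      fix v assume "v \<in> span {w}"
      then obtain k where "v = k *\<^sub>R w" by (auto simp: span_singleton)
      then have "v = outer_square w *v ((k / (w \<bullet> w)) *\<^sub>R w)"
        using assms by (simp add: outer_square_mult_vec)
      then show "v \<in> range ((*v) (outer_square w))" by blast
    qed
  qed
  then show ?thesis
    using assms by (simp add: rank_dim_range dim_span dim_eq_card_independent)
qed

text \<open>The usual discriminant argument for \<open>t \<mapsto> (u + t v)\<^sup>T A (u + t v)\<close>. The degenerate case
  \<open>v\<^sup>T A v = 0\<close> is needed below: it says that a zero diagonal entry forces a zero row.\<close>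

lemma pos_semidef_Cauchy_Schwarz:
  fixes A :: "real^'a::finite^'a"
  assumes "pos_semidef A"
  shows "(u \<bullet> (A *v v))\<^sup>2 \<le> (u \<bullet> (A *v u)) * (v \<bullet> (A *v v))"
proof -
  have sym: "transpose A = A" and nonneg: "\<And>x. 0 \<le> x \<bullet> (A *v x)"
    using assms by (auto simp: pos_semidef_def)
  define a b c where "a = v \<bullet> (A *v v)" "b = u \<bullet> (A *v v)" "c = u \<bullet> (A *v u)"
  have *: "0 \<le> c + 2 * t * b + t\<^sup>2 * a" for t
    using nonneg[of "u + t *\<^sub>R v"] by (simp add: symmetric_form_add_scaleR[OF sym] a_b_c_def)
  show ?thesis
  proof (cases "a = 0")
    case True
    have "b = 0"
    proof (rule ccontr)
      assume "b \<noteq> 0"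
      then show False using *[of "- (c + 1) / (2 * b)"] True by (simp add: field_simps)
    qed
    with True show ?thesis by (simp add: a_b_c_def)
  next
    case False
    with nonneg[of v] have "a > 0" by (simp add: a_b_c_def)
    with *[of "- b / a"] have "b\<^sup>2 \<le> c * a"
      by (simp add: field_simps power2_eq_square)
    then show ?thesis by (simp add: a_b_c_def)
  qed
qed

text \<open>Symmetric Gaussian elimination: subtracting the square of the scaled column \<open>a\<close> clears row and
  column \<open>a\<close>, and by the Cauchy--Schwarz inequality the rest stays positive semidefinite. A
  finite set containing the nonzero rows is the induction variable because the index type
  itself cannot shrink.\<close>

lemma pos_semidef_sum_outer_squares_support:
  fixes Y :: "real^'a::finite^'a"
  assumes "finite S" "pos_semidef Y" "\<And>r c. r \<notin> S \<Longrightarrow> Y $ r $ c = 0"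
  shows "\<exists>w. Y = (\<Sum>a\<in>S. outer_square (w a))"
  using assms
proof (induction S arbitrary: Y rule: finite_induct)
  case empty
  then show ?case by (simp add: vec_eq_iff)
next
  case (insert a S)
  have sym: "transpose Y = Y" and nonneg: "\<And>x. 0 \<le> x \<bullet> (Y *v x)"
    using insert.prems by (auto simp: pos_semidef_def)
  have sym_entry: "Y $ r $ c = Y $ c $ r" for r c
    using sym by (simp add: transpose_def vec_eq_iff)
  have diag: "0 \<le> Y $ a $ a"
    using nonneg[of "axis a 1"] by (simp add: matrix_entry_inner)
  \<comment> \<open>If the pivot is zero, so is its whole column, and division by zero makes \<open>wa\<close> vanish, as it
    should.\<close>
  define wa where "wa = (1 / sqrt (Y $ a $ a)) *\<^sub>R (Y *v axis a 1)"
  have wa_entry: "wa $ r = Y $ r $ a / sqrt (Y $ a $ a)" for r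
    using matrix_entry_inner[of r Y a] by (simp add: wa_def inner_axis')
  define Z where "Z = Y - outer_square wa"
  have Z_entry: "Z $ r $ c = Y $ r $ c - Y $ r $ a * Y $ c $ a / Y $ a $ a" for r c
    using diag by (simp add: Z_def outer_square_def wa_entry)
  have "pos_semidef Z"
    unfolding pos_semidef_def
  proof (intro conjI allI)
    show "transpose Z = Z"
      by (simp add: vec_eq_iff transpose_def Z_entry sym_entry mult.commute)
    fix v
    have "(wa \<bullet> v)\<^sup>2 = (v \<bullet> (Y *v axis a 1))\<^sup>2 / Y $ a $ a"
      using diag by (simp add: wa_def power_divide inner_commute)
    also have "\<dots> \<le> v \<bullet> (Y *v v)"
      using pos_semidef_Cauchy_Schwarz[OF insert.prems(1), of v "axis a 1"] diag nonneg[of v]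
      by (cases "Y $ a $ a = 0") (simp_all add: matrix_entry_inner divide_le_eq)
    finally show "0 \<le> v \<bullet> (Z *v v)"
      by (simp add: Z_def matrix_vector_mult_diff_rdistrib outer_square_mult_vec inner_diff_right
          power2_eq_square inner_commute)
  qed
  moreover have "Z $ r $ c = 0" if "r \<notin> S" for r c
  proof (cases "r = a")
    case True
    have "Y $ a $ c = 0" if "Y $ a $ a = 0"
      using pos_semidef_Cauchy_Schwarz[OF insert.prems(1), of "axis a 1" "axis c 1"] that
      by (simp add: matrix_entry_inner)
    then show ?thesis
      by (cases "Y $ a $ a = 0") (simp_all add: True Z_entry sym_entry[of c a])
  next
    case False
    then show ?thesis using insert.prems(2) that by (simp add: Z_entry)
  qed
  ultimately obtain w where "Z = (\<Sum>b\<in>S. outer_square (w b))"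
    using insert.IH by blast
  moreover have "(\<Sum>b\<in>S. outer_square ((w(a := wa)) b)) = (\<Sum>b\<in>S. outer_square (w b))"
    using insert.hyps by (intro sum.cong) auto
  ultimately have "Y = (\<Sum>b\<in>insert a S. outer_square ((w(a := wa)) b))"
    using insert.hyps by (simp add: Z_def algebra_simps)
  then show ?case by blast
qed

lemma pos_semidef_sum_outer_squares:
  fixes Y :: "real^'a::finite^'a"
  assumes "pos_semidef Y"
  obtains w :: "'a \<Rightarrow> real^'a" where "Y = (\<Sum>a\<in>UNIV. outer_square (w a))"
  using pos_semidef_sum_outer_squares_support[of UNIV Y] assms by auto

section \<open>Positive definite leading blocks\<close>

text \<open>The homogeneous vectors with last coordinate zero; together with the line spanned by any
  \<open>homog x\<close> they fill the whole space, which is how a condition on all homogeneous vectors is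
  reduced to one on the affine chart centred at \<open>x\<close>.\<close>

definition at_infinity_vec :: "real^'a::finite \<Rightarrow> real^('a option)" where
  "at_infinity_vec d = (\<chi> r. case r of Some a \<Rightarrow> d $ a | None \<Rightarrow> 0)"

lemma inner_at_infinity_vec:
  "at_infinity_vec d \<bullet> (A *v at_infinity_vec e) = d \<bullet> (top_left_block A *v e)"
  by (simp add: inner_vec_def sum_UNIV_option matrix_vector_mult_def at_infinity_vec_def
      top_left_block_def)

lemma norm_at_infinity_vec: "norm (at_infinity_vec d) = norm d"
  by (simp add: norm_eq_sqrt_inner inner_vec_def sum_UNIV_option at_infinity_vec_def)

lemma at_infinity_vec_homog_cases:
  obtains d where "v = at_infinity_vec d + (v $ None) *\<^sub>R homog x"
proof
  show "v = at_infinity_vec (\<chi> a. v $ Some a - v $ None * x $ a) + (v $ None) *\<^sub>R homog x"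
    by (auto simp: vec_eq_iff at_infinity_vec_def homog_def split: option.splits)
qed

lemma E_mat_form: "v \<bullet> (E_mat *v v) = (v $ None)\<^sup>2"
  by (simp add: inner_vec_def sum_UNIV_option matrix_vector_mult_def E_mat_def power2_eq_square)

lemma transpose_E_mat: "transpose E_mat = E_mat"
  by (auto simp: vec_eq_iff transpose_def E_mat_def)

text \<open>The constant is the minimum of the form on the compact unit sphere.\<close>

lemma pos_def_bounded_below:
  fixes A :: "real^'a::finite^'a"
  assumes "pos_def A"
  obtains c where "c > 0" "\<And>d. c * (norm d)\<^sup>2 \<le> d \<bullet> (A *v d)"
proof -
  let ?q = "\<lambda>d. d \<bullet> (A *v d)"
  have "continuous_on (sphere 0 1) ?q"
    by (intro continuous_intros linear_continuous_on matrix_vector_mul_bounded_linear)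
  then obtain e where e: "e \<in> sphere 0 1" and min: "\<And>d. d \<in> sphere 0 1 \<Longrightarrow> ?q e \<le> ?q d"
    using continuous_attains_inf[of "sphere 0 1" ?q] by (auto simp: compact_sphere)
  show ?thesis
  proof
    show "?q e > 0" using e assms norm_zero unfolding pos_def_def
      by (metis mem_sphere_0 zero_neq_one)
    fix d :: "real^'a"
    show "?q e * (norm d)\<^sup>2 \<le> ?q d"
    proof (cases "d = 0")
      case False
      with min[of "(1 / norm d) *\<^sub>R d"] show ?thesis
        by (simp add: matrix_vector_mult_scaleR field_simps power2_eq_square)
    qed simp
  qed
qed

text \<open>Stationary points of \<open>x \<mapsto> homog x \<bullet> (M *v homog x)\<close> solve a linear system whose matrix is the
  leading block, which is invertible. Expanding around the solution, the mixed term between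
  displacements and \<open>homog x\<close> vanishes.\<close>

lemma complete_square:
  fixes M :: "real^('a::finite option)^('a option)"
  assumes sym: "transpose M = M" and pd: "pos_def (top_left_block M)"
  obtains x where "\<And>d t. (at_infinity_vec d + t *\<^sub>R homog x) \<bullet> (M *v (at_infinity_vec d + t *\<^sub>R homog x))
    = d \<bullet> (top_left_block M *v d) + t\<^sup>2 * (homog x \<bullet> (M *v homog x))"
proof -
  let ?A = "top_left_block M"
  have "inj ((*v) ?A)"
  proof (rule linear_injective_0[THEN iffD2, rule_format])
    show "linear ((*v) ?A)" by simp
    fix d assume "?A *v d = 0"
    then have "\<not> 0 < d \<bullet> (?A *v d)" by simp
    then show "d = 0" using pd by (auto simp: pos_def_def)
  qed
  then have "surj ((*v) ?A)"
    using linear_injective_imp_surjective by (metis matrix_vector_mul_linear)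
  then obtain x where x: "?A *v x = - (\<chi> a. M $ Some a $ None)"
    by (metis surjD)
  have "(M *v homog x) $ Some a = 0" for a
  proof -
    have "(M *v homog x) $ Some a = M $ Some a $ None + (?A *v x) $ a"
      by (simp add: matrix_vector_mult_def sum_UNIV_option homog_def top_left_block_def)
    then show ?thesis by (simp add: x)
  qed
  then have orth: "at_infinity_vec d \<bullet> (M *v homog x) = 0" for d
    by (simp add: inner_vec_def sum_UNIV_option) (simp add: at_infinity_vec_def)
  show ?thesis
    by (rule that[of x])
       (simp add: symmetric_form_add_scaleR[OF sym] inner_at_infinity_vec orth)
qed

text \<open>First-order sensitivity of the minimum of a strictly convex quadratic. In the coordinates
  \<open>(d, t)\<close> around \<open>homog x\<close> the form of \<open>M\<close> does not depend on \<open>t\<close> and dominates a multiple of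
  \<open>|d|\<^sup>2\<close>. Adding \<open>s F\<close> with \<open>s\<close> small and of the right sign contributes a gain of order
  \<open>|s| t\<^sup>2\<close>, whereas the loss through the mixed term is only of order \<open>s\<^sup>2 t\<^sup>2\<close> once it is balanced
  against \<open>|d|\<^sup>2\<close>; so part of the gain can be spent on \<open>\<delta>\<close>. The bound covers all homogeneous
  vectors, including those with \<open>t = 0\<close>, because semidefiniteness of the matrix is required.\<close>

lemma improving_direction:
  fixes M F :: "real^('a::finite option)^('a option)"
  assumes symM: "transpose M = M" and symF: "transpose F = F"
    and pd: "pos_def (top_left_block M)"
    and M: "\<And>d t. (at_infinity_vec d + t *\<^sub>R homog x) \<bullet> (M *v (at_infinity_vec d + t *\<^sub>R homog x))
      = d \<bullet> (top_left_block M *v d)"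
    and F: "homog x \<bullet> (F *v homog x) \<noteq> 0"
  obtains s \<delta> where "\<delta> > 0" "pos_semidef (M + s *\<^sub>R F - \<delta> *\<^sub>R E_mat)"
proof -
  define \<phi> where "\<phi> = homog x \<bullet> (F *v homog x)"
  obtain c where c: "c > 0" "\<And>d. c * (norm d)\<^sup>2 \<le> d \<bullet> (top_left_block M *v d)"
    using pos_def_bounded_below[OF pd] by blast
  define K where "K = onorm ((*v) F) + norm (F *v homog x)"
  have Fn: "0 \<le> onorm ((*v) F)" "\<And>v. norm (F *v v) \<le> onorm ((*v) F) * norm v"
    by (simp_all add: onorm_pos_le onorm)
  then have K0: "K \<ge> 0" by (simp add: K_def)
  have K1: "\<bar>at_infinity_vec d \<bullet> (F *v at_infinity_vec d)\<bar> \<le> K * (norm d)\<^sup>2" for d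
  proof -
    have "\<bar>at_infinity_vec d \<bullet> (F *v at_infinity_vec d)\<bar> \<le> norm d * norm (F *v at_infinity_vec d)"
      using Cauchy_Schwarz_ineq2 norm_at_infinity_vec by metis
    also have "\<dots> \<le> norm d * (K * norm d)"
      using Fn(2)[of "at_infinity_vec d"]
      by (intro mult_left_mono)
         (auto simp: K_def norm_at_infinity_vec distrib_right intro: order_trans add_increasing2)
    finally show ?thesis by (simp add: power2_eq_square mult_ac)
  qed
  have K2: "\<bar>at_infinity_vec d \<bullet> (F *v homog x)\<bar> \<le> K * norm d" for d
  proof -
    have "\<bar>at_infinity_vec d \<bullet> (F *v homog x)\<bar> \<le> norm d * norm (F *v homog x)"
      using Cauchy_Schwarz_ineq2 norm_at_infinity_vec by metis
    also have "\<dots> \<le> norm d * K" using Fn(1) by (intro mult_left_mono) (auto simp: K_def)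
    finally show ?thesis by (simp add: mult_ac)
  qed
  define p where "p = \<bar>\<phi>\<bar>"
  have p: "p > 0" using F by (simp add: p_def \<phi>_def)
  \<comment> \<open>The step is small enough for \<open>c |d|\<^sup>2\<close> to absorb both the quadratic term of \<open>F\<close> and the part
    \<open>2 K\<^sup>2 / p |d|\<^sup>2\<close> of the mixed term; adding one keeps the denominator positive when \<open>K = 0\<close>.\<close>
  define B where "B = K + 2 * K\<^sup>2 / p + 1"
  have B: "B > 0" unfolding B_def using K0 p by (intro add_nonneg_pos add_nonneg_nonneg) auto
  define s where "s = c / B"
  have s: "s > 0" using c(1) B by (simp add: s_def)
  have sc: "s * (K + 2 * K\<^sup>2 / p) \<le> c"
  proof -
    have "s * (K + 2 * K\<^sup>2 / p) \<le> s * B" using s by (simp add: B_def)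
    then show ?thesis using B by (simp add: s_def)
  qed
  define \<sigma> where "\<sigma> = s * sgn \<phi>"
  have \<sigma>: "\<sigma> * \<phi> = s * p" "\<bar>\<sigma>\<bar> = s"
    using s p by (auto simp: \<sigma>_def p_def abs_mult abs_sgn_eq mult.assoc) (simp add: sgn_mult_abs abs_sgn mult.commute)
  show ?thesis
  proof
    show "s * p / 2 > 0" using s p by simp
    let ?N = "M + \<sigma> *\<^sub>R F - (s * p / 2) *\<^sub>R E_mat"
    show "pos_semidef ?N"
      unfolding pos_semidef_def
    proof (intro conjI allI)
      show "transpose ?N = ?N"
        using symM symF transpose_E_mat[where 'a='a] by (simp add: vec_eq_iff transpose_def)
      fix v :: "real^('a option)"
      define t where "t = v $ None"
      obtain d where v: "v = at_infinity_vec d + t *\<^sub>R homog x"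
        using at_infinity_vec_homog_cases t_def by metis
      let ?u = "at_infinity_vec d \<bullet> (F *v homog x)" and ?w = "at_infinity_vec d \<bullet> (F *v at_infinity_vec d)"
      have Fv: "v \<bullet> (F *v v) = ?w + 2 * t * ?u + t\<^sup>2 * \<phi>"
        unfolding v symmetric_form_add_scaleR[OF symF] \<phi>_def by simp
      have N: "v \<bullet> (?N *v v) = v \<bullet> (M *v v) + \<sigma> * (v \<bullet> (F *v v)) - s * p / 2 * t\<^sup>2"
        by (simp add: matrix_vector_mult_diff_rdistrib matrix_vector_mult_add_rdistrib
            inner_diff_right inner_add_right scaleR_matrix_vector_assoc[symmetric] E_mat_form t_def)
      have w: "\<sigma> * ?w \<ge> - (s * (K * (norm d)\<^sup>2))"
      proof -
        have "\<bar>\<sigma> * ?w\<bar> \<le> s * (K * (norm d)\<^sup>2)"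
          using K1[of d] s by (simp add: abs_mult \<sigma>)
        then show ?thesis by linarith
      qed
      \<comment> \<open>By the inequality of arithmetic and geometric means the mixed term costs at most half of
        the gain \<open>s p t\<^sup>2\<close>; the other half is the value chosen for \<open>\<delta>\<close>.\<close>
      have u: "\<sigma> * (2 * t * ?u) \<ge> - (s * (p / 2 * t\<^sup>2 + 2 * K\<^sup>2 / p * (norm d)\<^sup>2))"
      proof -
        have "\<bar>\<sigma> * (2 * t * ?u)\<bar> = s * (2 * \<bar>t\<bar> * \<bar>?u\<bar>)"
          by (simp add: abs_mult \<sigma>)
        also have "\<dots> \<le> s * (2 * \<bar>t\<bar> * (K * norm d))"
          using K2[of d] s by (intro mult_left_mono) auto
        also have "\<dots> \<le> s * (p / 2 * t\<^sup>2 + 2 * K\<^sup>2 / p * (norm d)\<^sup>2)"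
        proof (intro mult_left_mono)
          have "0 \<le> (p * \<bar>t\<bar> - 2 * (K * norm d))\<^sup>2 / (2 * p)" using p by simp
          also have "\<dots> = p / 2 * t\<^sup>2 + 2 * K\<^sup>2 / p * (norm d)\<^sup>2 - 2 * \<bar>t\<bar> * (K * norm d)"
            using p by (simp add: power2_diff power_mult_distrib field_simps power2_eq_square)
          finally show "2 * \<bar>t\<bar> * (K * norm d) \<le> p / 2 * t\<^sup>2 + 2 * K\<^sup>2 / p * (norm d)\<^sup>2" by simp
        qed (use s in simp)
        finally show ?thesis by linarith
      qed
      have m: "v \<bullet> (M *v v) \<ge> s * (K + 2 * K\<^sup>2 / p) * (norm d)\<^sup>2"
        using c(2)[of d] mult_right_mono[OF sc, of "(norm d)\<^sup>2"] unfolding v M by simp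
      have "\<sigma> * (v \<bullet> (F *v v)) = \<sigma> * ?w + \<sigma> * (2 * t * ?u) + s * p * t\<^sup>2"
        unfolding Fv \<sigma>(1)[symmetric] by (simp add: algebra_simps)
      with w u m show "0 \<le> v \<bullet> (?N *v v)"
        unfolding N by (simp add: algebra_simps)
    qed
  qed
qed

section \<open>Exactness of the relaxation\<close>

lemma top_left_block_linear: "linear top_left_block"
  by (rule linearI) (simp_all add: top_left_block_def vec_eq_iff)

lemma top_left_block_G_mat: "top_left_block (G_mat xh) = mat 1"
  by (auto simp: top_left_block_def G_mat_def mat_def vec_eq_iff)

lemma top_left_block_E_mat: "top_left_block E_mat = 0"
  by (auto simp: top_left_block_def E_mat_def vec_eq_iff)

definition slack ::
  "('n::{finite,linorder} \<Rightarrow> 'n \<Rightarrow> real^3^3) \<Rightarrow> real^('n \<times> 2) \<Rightarrow> ('n \<Rightarrow> 'n \<Rightarrow> real) \<Rightarrow> real \<Rightarrow>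
    real^(('n \<times> 2) option)^(('n \<times> 2) option)" where
  "slack \<Phi> xh lam \<rho> =
    G_mat xh + (\<Sum>(i, j)\<in>{(i, j). i < j}. lam i j *\<^sub>R F_mat \<Phi> i j) - \<rho> *\<^sub>R E_mat"

lemma dual_feasible_iff_slack: "(lam, \<rho>) \<in> dual_feasible \<Phi> xh \<longleftrightarrow> pos_semidef (slack \<Phi> xh lam \<rho>)"
  by (simp add: dual_feasible_def slack_def)

lemma top_left_block_slack:
  "top_left_block (slack \<Phi> xh lam \<rho>)
    = mat 1 + (\<Sum>(i, j)\<in>{(i, j). i < j}. lam i j *\<^sub>R H_mat \<Phi> i j)"
  unfolding slack_def
  by (simp add: linear_diff[OF top_left_block_linear] linear_add[OF top_left_block_linear]
      linear_sum[OF top_left_block_linear] linear_cmul[OF top_left_block_linear]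
      top_left_block_G_mat top_left_block_E_mat H_mat_def case_prod_unfold)

text \<open>When \<open>(lam, \<rho>)\<close> is dual feasible this is the duality gap, and weak duality is the
  nonnegativity of the inner product of two positive semidefinite matrices.\<close>

lemma slack_inner_feasible:
  assumes "Y \<in> primal_feasible \<Phi>"
  shows "slack \<Phi> xh lam \<rho> \<bullet> Y = G_mat xh \<bullet> Y - \<rho>"
proof -
  have "(\<Sum>(i, j)\<in>{(i, j). i < j}. lam i j *\<^sub>R F_mat \<Phi> i j) \<bullet> Y = 0"
    unfolding inner_sum_left
    by (rule sum.neutral) (use assms in \<open>auto simp: primal_feasible_def\<close>)
  then show ?thesis
    using assms by (simp add: slack_def inner_diff_left inner_add_left primal_feasible_def)
qed

lemma slack_raise: "slack \<Phi> xh lam (\<rho> + \<delta>) = slack \<Phi> xh lam \<rho> - \<delta> *\<^sub>R E_mat"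
  by (simp add: slack_def algebra_simps)

lemma slack_change_multiplier:
  assumes "i < j"
  shows "slack \<Phi> xh (lam(i := (lam i)(j := lam i j + s))) \<rho> = slack \<Phi> xh lam \<rho> + s *\<^sub>R F_mat \<Phi> i j"
proof -
  let ?lam = "lam(i := (lam i)(j := lam i j + s))"
  let ?S = "{(i, j). i < j} :: ('a \<times> 'a) set"
  have "(\<Sum>(k, l)\<in>?S. ?lam k l *\<^sub>R F_mat \<Phi> k l)
    = (\<Sum>q\<in>?S. (case q of (k, l) \<Rightarrow> lam k l *\<^sub>R F_mat \<Phi> k l) + (if q = (i, j) then s *\<^sub>R F_mat \<Phi> i j else 0))"
    by (rule sum.cong) (auto simp: scaleR_add_left split: if_splits)
  also have "\<dots> = (\<Sum>(k, l)\<in>?S. lam k l *\<^sub>R F_mat \<Phi> k l) + s *\<^sub>R F_mat \<Phi> i j"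
    using assms by (simp add: sum.distrib)
  finally show ?thesis by (simp add: slack_def algebra_simps)
qed

lemma homog_nonzero: "homog x \<noteq> 0"
proof
  assume "homog x = 0"
  then have "homog x $ None = 0" by simp
  then show False by (simp add: homog_def)
qed

text \<open>The moment relaxation contains the quadratic problem as its rank-one part.\<close>

lemma outer_square_homog_feasible:
  "outer_square (homog x) \<in> primal_feasible \<Phi> \<longleftrightarrow> x \<in> quad_feasible \<Phi>"
  using F_mat_represents[of \<Phi>]
  by (auto simp: primal_feasible_def quad_feasible_def inner_outer_square represents_quadratic_def
      E_mat_form pos_semidef_outer_square)
     (simp add: homog_def)

lemma G_mat_inner_outer_square_homog:
  "G_mat xh \<bullet> outer_square (homog x) = (norm (x - xh))\<^sup>2"
  using G_mat_represents[of xh] by (simp add: inner_outer_square represents_quadratic_def)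

theorem theorem3:
  fixes P :: "'n::{finite,linorder} \<Rightarrow> real^4^3"
    and \<Phi> :: "'n \<Rightarrow> 'n \<Rightarrow> real^3^3"
    and xh :: "real^('n \<times> 2)"
    and Y :: "real^(('n \<times> 2) option)^(('n \<times> 2) option)"
    and lam :: "'n \<Rightarrow> 'n \<Rightarrow> real"
    and \<rho> :: real
  assumes "CARD('n) \<ge> 2"
    and "\<And>i. rank (P i) = 3"
    and "\<And>i j. i \<noteq> j \<Longrightarrow> camera_center (P i) \<noteq> camera_center (P j)"
    and "\<And>i j. i < j \<Longrightarrow> is_fundamental_matrix (P i) (P j) (\<Phi> i j)"
    and "primal_optimal \<Phi> xh Y"
    and "dual_optimal \<Phi> xh lam \<rho>"
    and "pos_def (mat 1 + (\<Sum>(i, j)\<in>{(i, j). i < j}. lam i j *\<^sub>R H_mat \<Phi> i j))"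
  shows "rank Y = 1 \<and> sdp_exact \<Phi> xh"
proof -
  let ?M = "slack \<Phi> xh lam \<rho>"
  have psd: "pos_semidef ?M"
    and dual_max: "\<And>lam' \<rho>'. pos_semidef (slack \<Phi> xh lam' \<rho>') \<Longrightarrow> \<rho>' \<le> \<rho>"
    using assms(6) by (auto simp: dual_optimal_def dual_feasible_iff_slack)
  have Y: "Y \<in> primal_feasible \<Phi>"
    and Y_min: "\<And>Y'. Y' \<in> primal_feasible \<Phi> \<Longrightarrow> G_mat xh \<bullet> Y \<le> G_mat xh \<bullet> Y'"
    using assms(5) by (auto simp: primal_optimal_def)
  have pd: "pos_def (top_left_block ?M)"
    using assms(7) by (simp add: top_left_block_slack)
  have sym: "transpose ?M = ?M" and nonneg: "\<And>v. 0 \<le> v \<bullet> (?M *v v)"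
    using psd by (auto simp: pos_semidef_def)
  have pd_nonneg: "0 \<le> d \<bullet> (top_left_block ?M *v d)" for d
    using pd by (cases "d = 0") (auto simp: pos_def_def less_imp_le)
  obtain x where square: "\<And>d t. (at_infinity_vec d + t *\<^sub>R homog x) \<bullet>
      (?M *v (at_infinity_vec d + t *\<^sub>R homog x))
    = d \<bullet> (top_left_block ?M *v d) + t\<^sup>2 * (homog x \<bullet> (?M *v homog x))"
    using complete_square[OF sym pd] by blast

  \<comment> \<open>The minimum of the Lagrangian could be added to \<open>\<rho>\<close>, so it is zero.\<close>
  have x_kernel: "homog x \<bullet> (?M *v homog x) = 0"
  proof -
    let ?m = "homog x \<bullet> (?M *v homog x)"
    have "pos_semidef (slack \<Phi> xh lam (\<rho> + ?m))"
      unfolding pos_semidef_def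
    proof (intro conjI allI)
      show "transpose (slack \<Phi> xh lam (\<rho> + ?m)) = slack \<Phi> xh lam (\<rho> + ?m)"
        unfolding slack_raise using sym transpose_E_mat[where 'a="'n \<times> 2"]
        by (simp add: vec_eq_iff transpose_def)
      fix v
      obtain d where v: "v = at_infinity_vec d + (v $ None) *\<^sub>R homog x"
        using at_infinity_vec_homog_cases by blast
      have "v \<bullet> (?M *v v) = d \<bullet> (top_left_block ?M *v d) + (v $ None)\<^sup>2 * ?m"
        using square[of d "v $ None"] v by metis
      then show "0 \<le> v \<bullet> (slack \<Phi> xh lam (\<rho> + ?m) *v v)"
        using pd_nonneg[of d]
        by (simp add: slack_raise matrix_vector_mult_diff_rdistrib inner_diff_right
            scaleR_matrix_vector_assoc[symmetric] E_mat_form mult.commute)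
    qed
    from dual_max[OF this] nonneg[of "homog x"] show ?thesis by simp
  qed

  \<comment> \<open>A violated constraint is an ascent direction of the dual function.\<close>
  have x_feasible: "x \<in> quad_feasible \<Phi>"
    unfolding quad_feasible_def
  proof (intro CollectI allI impI, rule ccontr)
    fix i j :: 'n
    assume ij: "i < j" and "epipolar_form \<Phi> i j x \<noteq> 0"
    with F_mat_represents[of \<Phi> i j] have "homog x \<bullet> (F_mat \<Phi> i j *v homog x) \<noteq> 0"
      and "transpose (F_mat \<Phi> i j) = F_mat \<Phi> i j"
      by (auto simp: represents_quadratic_def)
    then obtain s \<delta> where "\<delta> > 0" "pos_semidef (?M + s *\<^sub>R F_mat \<Phi> i j - \<delta> *\<^sub>R E_mat)"
      using improving_direction[OF sym _ pd, of "F_mat \<Phi> i j" x] square x_kernel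
      by (metis add.right_neutral mult_zero_right)
    then have "pos_semidef (slack \<Phi> xh (lam(i := (lam i)(j := lam i j + s))) (\<rho> + \<delta>))"
      by (simp add: slack_raise slack_change_multiplier[OF ij])
    from dual_max[OF this] \<open>\<delta> > 0\<close> show False by simp
  qed

  let ?X = "outer_square (homog x)"
  have X: "?X \<in> primal_feasible \<Phi>"
    using x_feasible by (simp add: outer_square_homog_feasible)
  have X_value: "G_mat xh \<bullet> ?X = \<rho>"
    using slack_inner_feasible[OF X, of xh lam \<rho>] x_kernel by (simp add: inner_outer_square)

  obtain w :: "('n \<times> 2) option \<Rightarrow> real^(('n \<times> 2) option)" where w: "Y = (\<Sum>a\<in>UNIV. outer_square (w a))"
    using Y pos_semidef_sum_outer_squares by (auto simp: primal_feasible_def)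
  have sum: "?M \<bullet> Y = (\<Sum>a\<in>UNIV. w a \<bullet> (?M *v w a))"
    by (simp add: w inner_sum_right inner_outer_square)
  have MY: "?M \<bullet> Y = 0"
  proof (rule antisym)
    show "?M \<bullet> Y \<le> 0" using slack_inner_feasible[OF Y] Y_min[OF X] X_value by simp
    show "0 \<le> ?M \<bullet> Y" unfolding sum by (intro sum_nonneg nonneg)
  qed
  have Y_value: "G_mat xh \<bullet> Y = \<rho>"
    using MY slack_inner_feasible[OF Y, of xh lam \<rho>] by simp

  \<comment> \<open>Complementary slackness: each summand of \<open>Y\<close> lies in the kernel of the slack form.\<close>
  have w_multiple: "w a = (w a $ None) *\<^sub>R homog x" for a
  proof -
    obtain d where d: "w a = at_infinity_vec d + (w a $ None) *\<^sub>R homog x"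
      using at_infinity_vec_homog_cases by blast
    have "w a \<bullet> (?M *v w a) = 0"
      using MY sum_nonneg_eq_0_iff[of UNIV "\<lambda>a. w a \<bullet> (?M *v w a)"] nonneg by (simp add: sum)
    then have "d \<bullet> (top_left_block ?M *v d) = 0"
      using square[of d "w a $ None"] d x_kernel by simp
    then have "d = 0" using pd by (force simp: pos_def_def)
    moreover have "at_infinity_vec (0 :: real^('n \<times> 2)) = 0"
      using norm_at_infinity_vec[of "0 :: real^('n \<times> 2)"] by simp
    ultimately show ?thesis using d by simp
  qed
  have "Y = (\<Sum>a\<in>UNIV. (w a $ None)\<^sup>2) *\<^sub>R ?X"
    unfolding scaleR_sum_left outer_square_scaleR[symmetric] w_multiple[symmetric] by (rule w)
  moreover from this have "(\<Sum>a\<in>UNIV. (w a $ None)\<^sup>2) = 1"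
    using Y X unfolding primal_feasible_def by (metis (mono_tags, lifting) inner_scaleR_right mem_Collect_eq mult.right_neutral)
  ultimately have "Y = ?X" by simp
  then have "rank Y = 1" using rank_outer_square homog_nonzero by metis

  moreover have "g_sos \<Phi> xh = ereal \<rho>"
    unfolding g_sos_def
    by (rule antisym)
       (use psd dual_max in \<open>auto intro!: SUP_least SUP_upper2[of "(lam, \<rho>)"]
          simp: dual_feasible_iff_slack\<close>)
  moreover have "g_mom \<Phi> xh = ereal \<rho>"
    unfolding g_mom_def
    by (rule antisym) (use Y Y_min Y_value in \<open>auto intro!: INF_greatest INF_lower2[of Y]\<close>)
  moreover have "g_quad \<Phi> xh = ereal \<rho>"
    unfolding g_quad_def
  proof (rule antisym)
    show "(INF x\<in>quad_feasible \<Phi>. ereal ((norm (x - xh))\<^sup>2)) \<le> ereal \<rho>"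
      using x_feasible X_value by (auto intro!: INF_lower2[of x] simp: G_mat_inner_outer_square_homog)
    show "ereal \<rho> \<le> (INF x\<in>quad_feasible \<Phi>. ereal ((norm (x - xh))\<^sup>2))"
      using Y_min Y_value
      by (auto intro!: INF_greatest
          simp: outer_square_homog_feasible[symmetric] G_mat_inner_outer_square_homog[symmetric])
  qed
  ultimately show ?thesis by (simp add: sdp_exact_def)
qed

end
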